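(* Let $\pi$ be the constrained $\epsilon_t$-greedy strategy run with a sequence $\{\epsilon_t\}_{t\ge 1}$, $\epsilon_t\in(0,1]$, on a constrained multi-armed bandit with finite arm set $A$. Let $\rho := \min_{a,b\in A,\, a\neq b}|\mu_a-\mu_b|$ and $\eta:=\min_{a\in A}|C_a-C|$. Suppose that $\sum_{t=1}^{\infty}\epsilon_t=\infty$ and $\lim_{t\to\infty}\epsilon_t=0$, and that $\eta\neq0$ and $\rho\neq0$. Then $$\lim_{t\to\infty}\Pr\Bigl\{I^\pi_t\in\operatorname{arg\,max}_{a\in A_f}\mu_a\Bigr\}=1.$$
   Context: Constrained multi-armed bandit: $A$ is a finite set of arms with $|A|\ge 2$. For $a\in A$ and $t\ge 1$, $X_{a,t}$ is the sample reward and $Y_{a,t}$ the sample cost obtained if arm $a$ is played at time $t$. All the random variables $X_{a,t},Y_{a,t}$ ($a\in A$, $t\ge1$) are independent and take values in $[0,1]$; for each fixed $a$, the $X_{a,t}$, $t\ge 1$, are identically distributed with mean $\mu_a$, and the $Y_{a,t}$, $t\ge1$, are identically distributed with mean $C_a$. $C$ is a real constant, and $A_f:=\{a\in A\mid C_a\le C\}$ is assumed nonempty. Constrained $\epsilon_t$-greedy strategy $\pi$: $I^\pi_t\in A$ is the arm played at time $t$, and $T_a(t):=\sum_{n=1}^t[I^\pi_n=a]$ (indicator brackets), $T_a(0)=0$. The sample averages after the first $t$ plays are $\bar X_{T_a(t)}=\frac{1}{T_a(t)}\sum_{n=1}^tX_{a,n}[I^\pi_n=a]$ and $\bar Y_{T_a(t)}=\frac1{T_a(t)}\sum_{n=1}^tY_{a,n}[I^\pi_n=a]$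 if $T_a(t)\ge1$, and both are $0$ otherwise. At each time $t=1,2,\dots$: let $A_t=\{a\in A\mid T_a(t-1)\neq0 \text{ and } \bar Y_{T_a(t-1)}\le C\}$. With probability $1-\epsilon_t$ (greedy selection), $I^\pi_t\in\operatorname{arg\,max}_{a\in A_t}\bar X_{T_a(t-1)}$ if $A_t\ne\emptyset$ (ties broken arbitrarily), and $I^\pi_t$ is uniformly distributed over $A$ if $A_t=\emptyset$; with probability $\epsilon_t$ (random selection), $I^\pi_t$ is uniformly distributed over $A$. Then the bandit is played with $I^\pi_t$, and $X_{I^\pi_t,t}$ and $Y_{I^\pi_t,t}$ are observed. The randomization at time $t$ (the choice between greedy and random selection, and the uniform draws) is fresh, independent of the past and of all rewards and costs. *)

theory Defs
  imports "HOL-Probability.Probability"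
begin

text \<open>Plays and observations are indexed by times \<open>t \<ge> 1\<close>; index \<open>0\<close> of a process is
  never used.\<close>

definition plays :: "(nat \<Rightarrow> 'w \<Rightarrow> 'a) \<Rightarrow> 'a \<Rightarrow> nat \<Rightarrow> 'w \<Rightarrow> nat" where
  "plays I a t \<omega> = card {n \<in> {1..t}. I n \<omega> = a}"

definition sample_avg ::
    "(nat \<Rightarrow> 'w \<Rightarrow> 'a) \<Rightarrow> ('a \<Rightarrow> nat \<Rightarrow> 'w \<Rightarrow> real) \<Rightarrow> 'a \<Rightarrow> nat \<Rightarrow> 'w \<Rightarrow> real" where
  "sample_avg I Z a t \<omega> =
     (if plays I a t \<omega> \<ge> 1
      then (\<Sum>n=1..t. Z a n \<omega> * of_bool (I n \<omega> = a)) / real (plays I a t \<omega>)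
      else 0)"

definition feasible_arms :: "'a set \<Rightarrow> ('a \<Rightarrow> real) \<Rightarrow> real \<Rightarrow> 'a set" where
  "feasible_arms A c C = {a \<in> A. c a \<le> C}"

text \<open>The set \<open>A\<^sub>t\<close>, for \<open>t \<ge> 1\<close>.\<close>

definition empirically_feasible ::
    "'a set \<Rightarrow> (nat \<Rightarrow> 'w \<Rightarrow> 'a) \<Rightarrow> ('a \<Rightarrow> nat \<Rightarrow> 'w \<Rightarrow> real) \<Rightarrow> real \<Rightarrow> nat \<Rightarrow> 'w \<Rightarrow> 'a set" where
  "empirically_feasible A I Y C t \<omega> =
     {a \<in> A. plays I a (t - 1) \<omega> \<noteq> 0 \<and> sample_avg I Y a (t - 1) \<omega> \<le> C}"

definition reward_gap :: "'a set \<Rightarrow> ('a \<Rightarrow> real) \<Rightarrow> real" where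
  "reward_gap A \<mu> = Min {\<bar>\<mu> a - \<mu> b\<bar> | a b. a \<in> A \<and> b \<in> A \<and> a \<noteq> b}"

definition cost_gap :: "'a set \<Rightarrow> ('a \<Rightarrow> real) \<Rightarrow> real \<Rightarrow> real" where
  "cost_gap A c C = Min {\<bar>c a - C\<bar> | a. a \<in> A}"

text \<open>Rewards and costs as one family: \<open>Inl (a, t)\<close> stands for the reward and
  \<open>Inr (a, t)\<close> for the cost of arm \<open>a\<close> at time \<open>t\<close>.\<close>

type_synonym 'a sample_index = "('a \<times> nat) + ('a \<times> nat)"

definition sample ::
    "('a \<Rightarrow> nat \<Rightarrow> 'w \<Rightarrow> real) \<Rightarrow> ('a \<Rightarrow> nat \<Rightarrow> 'w \<Rightarrow> real) \<Rightarrow> 'a sample_index \<Rightarrow> 'w \<Rightarrow> real" where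
  "sample X Y = case_sum (\<lambda>(a, t). X a t) (\<lambda>(a, t). Y a t)"

definition sample_indices :: "'a set \<Rightarrow> nat set \<Rightarrow> 'a sample_index set" where
  "sample_indices A S = (A \<times> S) <+> (A \<times> S)"

locale constrained_bandit = prob_space M
  for M :: "'w measure" +
  fixes A :: "'a set"
    and X Y :: "'a \<Rightarrow> nat \<Rightarrow> 'w \<Rightarrow> real"
    and \<mu> c :: "'a \<Rightarrow> real"
    and C :: real
  assumes finite_arms: "finite A"
    and two_arms: "card A \<ge> 2"
    and indep_samples: "indep_vars (\<lambda>_. borel) (sample X Y) (sample_indices A {1..})"
    and reward_range: "\<And>a t \<omega>. a \<in> A \<Longrightarrow> t \<ge> 1 \<Longrightarrow> \<omega> \<in> space M \<Longrightarrow> X a t \<omega> \<in> {0..1}"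
    and cost_range: "\<And>a t \<omega>. a \<in> A \<Longrightarrow> t \<ge> 1 \<Longrightarrow> \<omega> \<in> space M \<Longrightarrow> Y a t \<omega> \<in> {0..1}"
    and reward_distr: "\<And>a t. a \<in> A \<Longrightarrow> t \<ge> 1 \<Longrightarrow> distr M borel (X a t) = distr M borel (X a 1)"
    and cost_distr: "\<And>a t. a \<in> A \<Longrightarrow> t \<ge> 1 \<Longrightarrow> distr M borel (Y a t) = distr M borel (Y a 1)"
    and reward_mean: "\<And>a. a \<in> A \<Longrightarrow> expectation (X a 1) = \<mu> a"
    and cost_mean: "\<And>a. a \<in> A \<Longrightarrow> expectation (Y a 1) = c a"
    and feasible_nonempty: "feasible_arms A c C \<noteq> {}"

text \<open>The randomization at time \<open>t\<close> is the triple \<open>(G t, U t, V t)\<close>: \<open>G t\<close> holds iff the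
  selection is greedy, \<open>U t\<close> is the uniform draw of a random selection, and \<open>V t\<close> is the
  uniform draw of a greedy selection when no arm is empirically feasible.

  Ties are broken by an arbitrary rule: the greedy arm is only required to be some maximizer, and
  it may depend on the past, on the current randomization and on further randomness. As the
  arm is chosen before anything is observed at time \<open>t\<close>, that choice cannot anticipate the
  samples of times \<open>\<ge> t\<close>; this is assumption \<open>nonanticipating\<close>.\<close>

definition randomization ::
    "(nat \<Rightarrow> 'w \<Rightarrow> bool) \<Rightarrow> (nat \<Rightarrow> 'w \<Rightarrow> 'a) \<Rightarrow> (nat \<Rightarrow> 'w \<Rightarrow> 'a) \<Rightarrow> nat \<Rightarrow> 'w \<Rightarrow> bool \<times> 'a \<times> 'a" where
  "randomization G U V t \<omega> = (G t \<omega>, U t \<omega>, V t \<omega>)"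

text \<open>The library's \<open>indep_var\<close> only relates random variables with one common codomain
  type, so independence of variables of different types is stated for the \<sigma>-algebras they
  generate.\<close>

definition generated_events :: "'w measure \<Rightarrow> ('w \<Rightarrow> 'b) \<Rightarrow> 'b measure \<Rightarrow> 'w set set" where
  "generated_events M f N = sets (vimage_algebra (space M) f N)"

locale constrained_eps_greedy = constrained_bandit M A X Y \<mu> c C
  for M :: "'w measure" and A :: "'a set" and X Y \<mu> c C +
  fixes \<epsilon> :: "nat \<Rightarrow> real"
    and I :: "nat \<Rightarrow> 'w \<Rightarrow> 'a"
    and G :: "nat \<Rightarrow> 'w \<Rightarrow> bool"
    and U V :: "nat \<Rightarrow> 'w \<Rightarrow> 'a"
  assumes arm_measurable: "\<And>t. t \<ge> 1 \<Longrightarrow> I t \<in> M \<rightarrow>\<^sub>M count_space A"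
    and mode_measurable: "\<And>t. t \<ge> 1 \<Longrightarrow> G t \<in> M \<rightarrow>\<^sub>M count_space UNIV"
    and draw_measurable: "\<And>t. t \<ge> 1 \<Longrightarrow> U t \<in> M \<rightarrow>\<^sub>M count_space A"
      "\<And>t. t \<ge> 1 \<Longrightarrow> V t \<in> M \<rightarrow>\<^sub>M count_space A"
    and randomization_distr: "\<And>t. t \<ge> 1 \<Longrightarrow>
      distr M (count_space UNIV) (randomization G U V t) =
      measure_pmf (pair_pmf (bernoulli_pmf (1 - \<epsilon> t)) (pair_pmf (pmf_of_set A) (pmf_of_set A)))"
    and fresh_randomization: "\<And>t. t \<ge> 1 \<Longrightarrow>
      indep_set
        (generated_events M (randomization G U V t) (count_space UNIV))
        (generated_events M
          (\<lambda>\<omega>. (\<lambda>s\<in>{1..<t}. (I s \<omega>, randomization G U V s \<omega>),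
                \<lambda>i\<in>sample_indices A {1..}. sample X Y i \<omega>))
          (PiM {1..<t} (\<lambda>_. count_space UNIV) \<Otimes>\<^sub>M PiM (sample_indices A {1..}) (\<lambda>_. borel)))"
    and nonanticipating: "\<And>t. t \<ge> 1 \<Longrightarrow>
      indep_set
        (generated_events M
          (\<lambda>\<omega>. (\<lambda>s\<in>{1..t}. (I s \<omega>, randomization G U V s \<omega>),
                \<lambda>i\<in>sample_indices A {1..<t}. sample X Y i \<omega>))
          (PiM {1..t} (\<lambda>_. count_space UNIV) \<Otimes>\<^sub>M PiM (sample_indices A {1..<t}) (\<lambda>_. borel)))
        (generated_events M
          (\<lambda>\<omega>. \<lambda>i\<in>sample_indices A {t..}. sample X Y i \<omega>)
          (PiM (sample_indices A {t..}) (\<lambda>_. borel)))"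
    and greedy_selection: "\<And>t \<omega>. t \<ge> 1 \<Longrightarrow> \<omega> \<in> space M \<Longrightarrow> G t \<omega> \<Longrightarrow>
      empirically_feasible A I Y C t \<omega> \<noteq> {} \<Longrightarrow>
      is_arg_max (\<lambda>a. sample_avg I X a (t - 1) \<omega>)
        (\<lambda>a. a \<in> empirically_feasible A I Y C t \<omega>) (I t \<omega>)"
    and greedy_selection_empty: "\<And>t \<omega>. t \<ge> 1 \<Longrightarrow> \<omega> \<in> space M \<Longrightarrow> G t \<omega> \<Longrightarrow>
      empirically_feasible A I Y C t \<omega> = {} \<Longrightarrow> I t \<omega> = V t \<omega>"
    and random_selection: "\<And>t \<omega>. t \<ge> 1 \<Longrightarrow> \<omega> \<in> space M \<Longrightarrow> \<not> G t \<omega> \<Longrightarrow> I t \<omega> = U t \<omega>"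

end

theory Submission
  imports Defs
begin

text \<open>
  Fix an arm \<open>a\<close> and let \<open>T\<close> be its number of plays and \<open>S\<close> the sum of the centered samples
  observed on those plays. Since the decision to play \<open>a\<close> does not anticipate the sample,
  Hoeffding's lemma makes \<open>exp (l * S - l\<^sup>2 / 8 * T)\<close> a supermartingale. Taking
  \<open>l = \<plusminus> 4 * d\<close>, Markov's inequality bounds the probability of \<open>T \<ge> k\<close> and \<open>\<bar>S\<bar> \<ge> d * T\<close> by
  \<open>2 * exp (- 2 * d\<^sup>2 * k)\<close>, uniformly in time. Random selections play \<open>a\<close> independently
  with probability \<open>\<epsilon>\<^sub>t / \<bar>A\<bar>\<close>, so \<open>T\<close> tends to infinity in probability because \<open>\<Sum> \<epsilon>\<^sub>t\<close> diverges,
  and all sample averages are consistent. Once they are within \<open>\<rho> / 2\<close> and \<open>\<eta>\<close> of the means,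
  a greedy selection is optimal, and the selection is greedy with probability \<open>1 - \<epsilon>\<^sub>t \<rightarrow> 1\<close>.
\<close>

section \<open>Products of expectations under independence, and Hoeffding's lemma\<close>

lemma (in prob_space) expectation_mult_indep_set:
  fixes f g :: "'a \<Rightarrow> real"
  assumes "space P = space M" "space Q = space M" and indep: "indep_set (sets P) (sets Q)"
    and f: "f \<in> borel_measurable P" "integrable M f"
    and g: "g \<in> borel_measurable Q" "integrable M g"
  shows "expectation (\<lambda>\<omega>. f \<omega> * g \<omega>) = expectation f * expectation g"
proof (rule indep_var_lebesgue_integral[OF _ f(2) g(2)])
  \<comment> \<open>Measurability of \<open>h\<close> in \<open>N\<close> puts every preimage of a
    Borel set into \<open>sets N\<close>. Hence the sigma-algebras generated by \<open>f\<close> and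
    \<open>g\<close> inherit independence from \<open>P\<close> and \<open>Q\<close>.\<close>
  have gen: "sigma_sets (space M) {h -` B \<inter> space M |B. B \<in> sets borel} \<subseteq> sets N"
    if "space N = space M" "h \<in> borel_measurable N" for h :: "'a \<Rightarrow> real" and N
    using sets_image_in_sets[OF that] by (simp add: sets_vimage_algebra)
  have "indep_set (sigma_sets (space M) {f -` B \<inter> space M |B. B \<in> sets borel})
      (sigma_sets (space M) {g -` B \<inter> space M |B. B \<in> sets borel})"
    using indep gen[OF assms(1) f(1)] gen[OF assms(2) g(1)]
    unfolding indep_sets2_eq by blast
  then show "indep_var borel f borel g"
    unfolding indep_var_eq using f(2) g(2) by auto
qed

text \<open>Hoeffding's lemma for a range of length 1 and either sign of \<open>l\<close>: a
  negative \<open>l\<close> acts on \<open>Z\<close> as \<open>- l\<close> does on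
  \<open>- Z\<close>, which takes values in [-1, 0].\<close>

lemma (in prob_space) expectation_exp_centered_le:
  fixes Z :: "'a \<Rightarrow> real"
  assumes [measurable]: "Z \<in> borel_measurable M"
    and range: "\<And>\<omega>. \<omega> \<in> space M \<Longrightarrow> Z \<omega> \<in> {0..1}"
  shows "expectation (\<lambda>\<omega>. exp (l * (Z \<omega> - expectation Z))) \<le> exp (l\<^sup>2 / 8)"
proof -
  \<comment> \<open>Passes from the nonnegative integral to the Bochner integral. If
    \<open>h\<close> is not integrable, the latter is 0 by convention and \<open>0 \<le> r\<close>
    applies.\<close>
  have real: "expectation h \<le> r"
    if "(\<integral>\<^sup>+\<omega>. ennreal (h \<omega>) \<partial>M) \<le> ennreal r" "0 \<le> r" "\<And>\<omega>. 0 \<le> h \<omega>"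
      "h \<in> borel_measurable M" for h r
  proof (cases "integrable M h")
    case True
    then show ?thesis
      using nn_integral_eq_integral[OF True] that by (simp add: ennreal_le_iff)
  qed (use that in \<open>simp add: not_integrable_integral_eq\<close>)
  consider "l = 0" | "l > 0" | "l < 0" by linarith
  then show ?thesis
  proof cases
    case 2
    interpret interval_bounded_random_variable M Z 0 1
      by unfold_locales (use range in auto)
    show ?thesis
      by (rule real) (use Hoeffdings_lemma_nn_integral[OF 2] in auto)
  next
    case 3
    interpret interval_bounded_random_variable M "\<lambda>\<omega>. - Z \<omega>" "-1" 0
      by unfold_locales (use range in auto)
    show ?thesis
      by (rule real) (use Hoeffdings_lemma_nn_integral[of "-l"] 3 in
          \<open>auto simp: algebra_simps\<close>)
  qed (simp add: prob_space)
qed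

section \<open>Exponential supermartingale of selectively observed samples\<close>

text \<open>\<open>P t\<close> contains what is known when the sample \<open>Z t\<close> is either selected or skipped,
  and \<open>Q t\<close> the samples not yet observed at that moment.\<close>

locale selected_samples = prob_space M for M :: "'w measure" +
  fixes P Q :: "nat \<Rightarrow> 'w measure" and Z :: "nat \<Rightarrow> 'w \<Rightarrow> real"
    and J :: "nat \<Rightarrow> 'w \<Rightarrow> bool" and m :: real
  assumes space_P: "\<And>t. space (P t) = space M" and space_Q: "\<And>t. space (Q t) = space M"
    and indep: "\<And>t. t \<ge> 1 \<Longrightarrow> indep_set (sets (P t)) (sets (Q t))"
    and Z_past: "\<And>n t. 1 \<le> n \<Longrightarrow> n < t \<Longrightarrow> Z n \<in> borel_measurable (P t)"
    and J_past: "\<And>n t. 1 \<le> n \<Longrightarrow> n \<le> t \<Longrightarrow> Measurable.pred (P t) (J n)"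
    and Z_future: "\<And>t. 1 \<le> t \<Longrightarrow> Z t \<in> borel_measurable (Q t)"
    and Z_range: "\<And>t \<omega>. 1 \<le> t \<Longrightarrow> \<omega> \<in> space M \<Longrightarrow> Z t \<omega> \<in> {0..1}"
    and Z_mean: "\<And>t. 1 \<le> t \<Longrightarrow> expectation (Z t) = m"
begin

text \<open>Independence in the sense of \<open>indep_set\<close> includes that the sets are events,
  so \<open>P t\<close> is a sub-sigma-algebra of \<open>M\<close>.\<close>

lemma measurable_P: "t \<ge> 1 \<Longrightarrow> f \<in> measurable (P t) N \<Longrightarrow> f \<in> measurable M N"
  by (rule measurable_from_subalg[rotated])
    (use indep_setD_ev1[OF indep[of t]] in \<open>auto simp: subalgebra_def space_P\<close>)

lemma measurable_Q: "t \<ge> 1 \<Longrightarrow> f \<in> measurable (Q t) N \<Longrightarrow> f \<in> measurable M N"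
  by (rule measurable_from_subalg[rotated])
    (use indep_setD_ev2[OF indep[of t]] in \<open>auto simp: subalgebra_def space_Q\<close>)

lemma Z_measurable: "t \<ge> 1 \<Longrightarrow> Z t \<in> borel_measurable M"
  using measurable_Q Z_future by blast

lemma J_measurable: "t \<ge> 1 \<Longrightarrow> Measurable.pred M (J t)"
  using measurable_P J_past by blast

lemma centered_le:
  assumes "1 \<le> t" "\<omega> \<in> space M"
  shows "l * (Z t \<omega> - m) \<le> \<bar>l\<bar> * (1 + \<bar>m\<bar>)"
proof -
  have "l * (Z t \<omega> - m) \<le> \<bar>l\<bar> * \<bar>Z t \<omega> - m\<bar>"
    by (metis abs_ge_self abs_mult)
  also have "\<dots> \<le> \<bar>l\<bar> * (1 + \<bar>m\<bar>)"
    by (intro mult_left_mono) (use Z_range[OF assms] in auto)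
  finally show ?thesis .
qed

text \<open>The supermartingale \<open>exp (l * S - l\<^sup>2 / 8 * T)\<close>, written as one sum:
  every selected sample carries its own compensator \<open>l\<^sup>2 / 8\<close>, and a skipped one
  contributes 0.\<close>

definition weight :: "real \<Rightarrow> nat \<Rightarrow> 'w \<Rightarrow> real" where
  "weight l t \<omega> = exp (\<Sum>n=1..t. (l * (Z n \<omega> - m) - l\<^sup>2 / 8) * of_bool (J n \<omega>))"

text \<open>Isolates the newest sample. Its exponential is measurable in \<open>Q (Suc t)\<close>,
  while the weight and the selection indicators are measurable in \<open>P (Suc t)\<close>.\<close>

lemma weight_Suc:
  "weight l (Suc t) \<omega> = weight l t \<omega> * of_bool (\<not> J (Suc t) \<omega>) +
    exp (- l\<^sup>2 / 8) * ((weight l t \<omega> * of_bool (J (Suc t) \<omega>)) * exp (l * (Z (Suc t) \<omega> - m)))"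
  by (auto simp: weight_def exp_add[symmetric] algebra_simps)

lemma integrable_weight: "integrable M (weight l t)"
proof (rule integrable_const_bound)
  let ?B = "\<Sum>n=1..t. \<bar>l\<bar> * (1 + \<bar>m\<bar>)"
  show "AE \<omega> in M. norm (weight l t \<omega>) \<le> exp ?B"
  proof (rule AE_I2)
    fix \<omega> assume \<omega>: "\<omega> \<in> space M"
    have "(l * (Z n \<omega> - m) - l\<^sup>2 / 8) * of_bool (J n \<omega>) \<le> \<bar>l\<bar> * (1 + \<bar>m\<bar>)"
      if "n \<in> {1..t}" for n
    proof -
      have "l * (Z n \<omega> - m) - l\<^sup>2 / 8 \<le> \<bar>l\<bar> * (1 + \<bar>m\<bar>)"
      proof -
        have "l * (Z n \<omega> - m) \<le> \<bar>l\<bar> * (1 + \<bar>m\<bar>)"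
          using centered_le[of n \<omega> l] \<omega> that by simp
        moreover have "0 \<le> l\<^sup>2 / 8" by simp
        ultimately show ?thesis by linarith
      qed
      then show ?thesis
        by (cases "J n \<omega>") simp_all
    qed
    then show "norm (weight l t \<omega>) \<le> exp ?B"
      unfolding weight_def by (simp only: real_norm_def abs_exp_cancel exp_le_cancel_iff sum_mono)
  qed
  have [measurable]: "Z n \<in> borel_measurable M" "Measurable.pred M (J n)" if "n \<in> {1..t}" for n
    using that Z_measurable J_measurable by auto
  show "weight l t \<in> borel_measurable M"
    unfolding weight_def by measurable
qed

text \<open>A skipped sample leaves the weight unchanged. A selected one multiplies it by a factor
  that is independent of what precedes it and has mean at most 1 by Hoeffding's lemma.\<close>

lemma expectation_weight_le: "expectation (weight l t) \<le> 1"
proof (induction t)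
  case 0
  then show ?case by (simp add: weight_def prob_space)
next
  case (Suc t)
  let ?t = "Suc t"
  have [measurable]: "Z n \<in> borel_measurable (P ?t)" "Measurable.pred (P ?t) (J n)"
    if "n \<in> {1..t}" for n
    using that by (auto intro!: Z_past J_past)
  have [measurable]: "Measurable.pred (P ?t) (J ?t)" "Z ?t \<in> borel_measurable (Q ?t)"
    "Z ?t \<in> borel_measurable M" "Measurable.pred M (J ?t)"
    by (auto intro!: J_past Z_future J_measurable Z_measurable)
  have int_sel: "integrable M (\<lambda>\<omega>. weight l t \<omega> * of_bool (R \<omega>))"
    if [measurable]: "Measurable.pred M R" for R
    by (rule Bochner_Integration.integrable_bound[OF integrable_weight[of l t]]) (use integrable_weight in auto)
  have int_exp: "integrable M (\<lambda>\<omega>. exp (l * (Z ?t \<omega> - m)))"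
  proof (rule integrable_const_bound)
    show "AE \<omega> in M. norm (exp (l * (Z ?t \<omega> - m))) \<le> exp (\<bar>l\<bar> * (1 + \<bar>m\<bar>))"
      using centered_le[of ?t] by (intro AE_I2) simp
  qed measurable
  let ?E = "expectation (\<lambda>\<omega>. exp (l * (Z ?t \<omega> - m)))"
  \<comment> \<open>The decision \<open>J (Suc t)\<close> already belongs to
    \<open>P (Suc t)\<close>, whereas the sample belongs to \<open>Q (Suc t)\<close>. This is where
    nonanticipation enters.\<close>
  have split: "expectation (\<lambda>\<omega>. (weight l t \<omega> * of_bool (J ?t \<omega>)) * exp (l * (Z ?t \<omega> - m))) =
      expectation (\<lambda>\<omega>. weight l t \<omega> * of_bool (J ?t \<omega>)) * ?E"
  proof (rule expectation_mult_indep_set[OF space_P[of ?t] space_Q[of ?t] indep])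
    show "(\<lambda>\<omega>. weight l t \<omega> * of_bool (J ?t \<omega>)) \<in> borel_measurable (P ?t)"
      unfolding weight_def by measurable
    show "(\<lambda>\<omega>. exp (l * (Z ?t \<omega> - m))) \<in> borel_measurable (Q ?t)"
      by measurable
  qed (auto intro!: int_sel int_exp)
  have split_int: "integrable M
      (\<lambda>\<omega>. (weight l t \<omega> * of_bool (J ?t \<omega>)) * exp (l * (Z ?t \<omega> - m)))"
  proof (rule Bochner_Integration.integrable_bound)
    show "integrable M (\<lambda>\<omega>. exp (\<bar>l\<bar> * (1 + \<bar>m\<bar>)) * weight l t \<omega>)"
      using integrable_weight by simp
    show "AE \<omega> in M. norm (weight l t \<omega> * of_bool (J ?t \<omega>) * exp (l * (Z ?t \<omega> - m)))
        \<le> norm (exp (\<bar>l\<bar> * (1 + \<bar>m\<bar>)) * weight l t \<omega>)"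
      using centered_le[of ?t] by (intro AE_I2) (auto simp: weight_def mult.commute)
    show "(\<lambda>\<omega>. weight l t \<omega> * of_bool (J ?t \<omega>) * exp (l * (Z ?t \<omega> - m))) \<in> borel_measurable M"
      using integrable_weight[of l t] by measurable
  qed
  have "?E \<le> exp (l\<^sup>2 / 8)"
    using expectation_exp_centered_le[OF Z_measurable[of ?t] Z_range[of ?t], of l]
    by (simp add: Z_mean)
  then have E: "exp (- l\<^sup>2 / 8) * ?E \<le> 1"
    by (simp add: exp_minus field_simps)
  have "expectation (weight l ?t) =
      expectation (\<lambda>\<omega>. weight l t \<omega> * of_bool (\<not> J ?t \<omega>)) +
      exp (- l\<^sup>2 / 8) * (expectation (\<lambda>\<omega>. weight l t \<omega> * of_bool (J ?t \<omega>)) * ?E)"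
    unfolding weight_Suc split[symmetric]
    by (subst Bochner_Integration.integral_add) (auto intro!: int_sel split_int)
  also have "\<dots> = expectation (\<lambda>\<omega>. weight l t \<omega> * of_bool (\<not> J ?t \<omega>)) +
      expectation (\<lambda>\<omega>. weight l t \<omega> * of_bool (J ?t \<omega>)) * (exp (- l\<^sup>2 / 8) * ?E)"
    by simp
  also have "\<dots> \<le> expectation (\<lambda>\<omega>. weight l t \<omega> * of_bool (\<not> J ?t \<omega>)) +
      expectation (\<lambda>\<omega>. weight l t \<omega> * of_bool (J ?t \<omega>))"
    by (intro add_left_mono mult_left_le E Bochner_Integration.integral_nonneg)
      (auto simp: weight_def)
  also have "\<dots> = expectation (weight l t)"
    by (subst Bochner_Integration.integral_add[symmetric])
      (auto intro!: int_sel Bochner_Integration.integral_cong)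
  finally show ?case using Suc by simp
qed

lemma prob_weight_ge: "0 < x \<Longrightarrow> prob {\<omega> \<in> space M. x \<le> weight l t \<omega>} \<le> 1 / x"
proof -
  assume "0 < x"
  then have "prob {\<omega> \<in> space M. x \<le> weight l t \<omega>} \<le> expectation (weight l t) / x"
    by (intro integral_Markov_inequality_measure[where A = "{}"] integrable_weight)
      (auto simp: weight_def)
  also have "\<dots> \<le> 1 / x"
    using \<open>0 < x\<close> expectation_weight_le by (intro divide_right_mono) auto
  finally show ?thesis .
qed

text \<open>The exponent \<open>l * d - l\<^sup>2 / 8\<close> per selected sample is largest at
  \<open>l = 4 * d\<close>, with value \<open>2 * d\<^sup>2\<close>. The weight is then at least
  \<open>exp (2 * d\<^sup>2 * T)\<close>, which exceeds the threshold for all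
  \<open>T \<ge> k\<close> simultaneously, so the random number of selections costs no union
  bound.\<close>

lemma prob_deviation_le:
  assumes "0 < d"
  shows "prob {\<omega> \<in> space M. k \<le> (\<Sum>n=1..t. of_bool (J n \<omega>)) \<and>
      d * (\<Sum>n=1..t. of_bool (J n \<omega>)) \<le> \<bar>\<Sum>n=1..t. (Z n \<omega> - m) * of_bool (J n \<omega>)\<bar>}
    \<le> 2 * exp (- 2 * d\<^sup>2 * k)"
proof -
  let ?T = "\<lambda>\<omega>. \<Sum>n=1..t. of_bool (J n \<omega>) :: real"
  let ?S = "\<lambda>\<omega>. \<Sum>n=1..t. (Z n \<omega> - m) * of_bool (J n \<omega>)"
  let ?x = "exp (2 * d\<^sup>2 * k)"
  let ?W = "\<lambda>l. {\<omega> \<in> space M. ?x \<le> weight l t \<omega>}"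
  have [measurable]: "weight l t \<in> borel_measurable M" for l
    using integrable_weight by blast
  have weight_eq: "weight l t \<omega> = exp (l * ?S \<omega> - l\<^sup>2 / 8 * ?T \<omega>)" for l \<omega>
    unfolding weight_def sum_distrib_left sum_subtractf[symmetric]
    by (intro arg_cong[where f = exp] sum.cong) (auto simp: algebra_simps)
  have "{\<omega> \<in> space M. k \<le> ?T \<omega> \<and> d * ?T \<omega> \<le> \<bar>?S \<omega>\<bar>} \<subseteq> ?W (4 * d) \<union> ?W (- 4 * d)"
  proof safe
    fix \<omega> assume \<omega>: "\<omega> \<in> space M" "k \<le> ?T \<omega>" "d * ?T \<omega> \<le> \<bar>?S \<omega>\<bar>"
      and "\<not> ?x \<le> weight (- 4 * d) t \<omega>"
    have "2 * d\<^sup>2 * k \<le> 2 * d\<^sup>2 * ?T \<omega>"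
      using \<omega>(2) by (intro mult_left_mono) auto
    also have "\<dots> = 4 * d * (d * ?T \<omega>) - (4 * d)\<^sup>2 / 8 * ?T \<omega>"
      by (simp add: power2_eq_square)
    also have "\<dots> \<le> 4 * d * \<bar>?S \<omega>\<bar> - (4 * d)\<^sup>2 / 8 * ?T \<omega>"
      using \<omega>(3) assms by (intro diff_right_mono mult_left_mono) auto
    \<comment> \<open>The sign of \<open>S\<close> decides which of the two weights is
      large.\<close>
    finally have "?x \<le> weight (4 * d) t \<omega> \<or> ?x \<le> weight (- 4 * d) t \<omega>"
      unfolding weight_eq by (cases "0 \<le> ?S \<omega>") auto
    then show "?x \<le> weight (4 * d) t \<omega>"
      using \<open>\<not> ?x \<le> weight (- 4 * d) t \<omega>\<close> by blast
  qed
  then have "prob {\<omega> \<in> space M. k \<le> ?T \<omega> \<and> d * ?T \<omega> \<le> \<bar>?S \<omega>\<bar>} \<le> prob (?W (4 * d) \<union> ?W (- 4 * d))"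
    by (intro finite_measure_mono) measurable
  also have "\<dots> \<le> prob (?W (4 * d)) + prob (?W (- 4 * d))"
    by (rule measure_Un_le) measurable
  also have "\<dots> \<le> 1 / ?x + 1 / ?x"
    by (intro add_mono prob_weight_ge) auto
  finally show ?thesis
    by (simp add: exp_minus field_simps)
qed

end

section \<open>Lower tail of a count of successes\<close>

text \<open>Markov's inequality for \<open>exp (- N)\<close>, where \<open>N\<close> counts the
  successes. Each trial is independent of the earlier ones and multiplies the expectation by at most
  \<open>exp (- (1 - exp (- 1)) * p n)\<close>. The bound vanishes when the sum of the
  \<open>p n\<close> diverges.\<close>

lemma (in prob_space) prob_few_successes_le:
  fixes F H :: "nat \<Rightarrow> 'a measure" and B :: "nat \<Rightarrow> 'a \<Rightarrow> bool"
  assumes space: "\<And>t. space (F t) = space M" "\<And>t. space (H t) = space M"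
    and indep: "\<And>t. t \<ge> 1 \<Longrightarrow> indep_set (sets (F t)) (sets (H t))"
    and past: "\<And>n t. 1 \<le> n \<Longrightarrow> n < t \<Longrightarrow> Measurable.pred (F t) (B n)"
    and present: "\<And>t. 1 \<le> t \<Longrightarrow> Measurable.pred (H t) (B t)"
    and prob: "\<And>t. 1 \<le> t \<Longrightarrow> \<P>(\<omega> in M. B t \<omega>) = p t"
  shows "\<P>(\<omega> in M. (\<Sum>n=1..t. of_bool (B n \<omega>)) \<le> k) \<le>
    exp k * exp (- (1 - exp (- 1)) * (\<Sum>n=1..t. p n))"
proof -
  have B_M: "Measurable.pred M (B t)" if "t \<ge> 1" for t
    by (rule measurable_from_subalg[OF _ present[OF that]])
      (use indep_setD_ev2[OF indep[OF that]] in \<open>auto simp: subalgebra_def space\<close>)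
  let ?N = "\<lambda>t \<omega>. \<Sum>n=1..t. of_bool (B n \<omega>) :: real"
  have mN: "?N t \<in> borel_measurable M" for t
    using B_M by measurable
  have int: "integrable M (\<lambda>\<omega>. exp (- ?N t \<omega>))" for t
    by (rule integrable_const_bound[where B = 1]) (use mN in \<open>auto intro!: AE_I2 sum_nonneg\<close>)
  have le: "expectation (\<lambda>\<omega>. exp (- ?N t \<omega>)) \<le> exp (- (1 - exp (- 1)) * (\<Sum>n=1..t. p n))"
  proof (induction t)
    case 0
    then show ?case by (simp add: prob_space)
  next
    case (Suc t)
    let ?t = "Suc t"
    let ?q = "(1 - exp (- 1)) :: real"
    have [measurable]: "Measurable.pred (F ?t) (B n)" if "n \<in> {1..t}" for n
      using that by (auto intro: past)
    have [measurable]: "Measurable.pred (H ?t) (B ?t)"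
      by (auto intro: present)
    \<comment> \<open>On the values 0 and 1 the function \<open>exp (- x)\<close> agrees with the
      affine function \<open>1 - ?q * x\<close>, whose mean is explicit.\<close>
    have "expectation (\<lambda>\<omega>. exp (- of_bool (B ?t \<omega>)) :: real) =
        expectation (\<lambda>\<omega>. 1 - ?q * indicator {\<omega> \<in> space M. B ?t \<omega>} \<omega>)"
      by (intro Bochner_Integration.integral_cong) (auto simp: indicator_def)
    also have "\<dots> = 1 - ?q * p ?t"
    proof -
      have ev: "{\<omega> \<in> space M. B ?t \<omega>} \<in> events"
        using B_M[of ?t] by measurable
      then have "integrable M (indicator {\<omega> \<in> space M. B ?t \<omega>} :: 'a \<Rightarrow> real)"
        by (simp add: emeasure_eq_measure)
      then show ?thesis
        by (subst Bochner_Integration.integral_diff) (auto simp: prob_space prob[symmetric] sets.Int_space_eq2[OF ev])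
    qed
    also have "\<dots> \<le> exp (- ?q * p ?t)"
      using exp_ge_add_one_self[of "- ?q * p ?t"] by linarith
    finally have step: "expectation (\<lambda>\<omega>. exp (- of_bool (B ?t \<omega>)) :: real) \<le> exp (- ?q * p ?t)" .
    have "expectation (\<lambda>\<omega>. exp (- ?N ?t \<omega>)) =
        expectation (\<lambda>\<omega>. exp (- ?N t \<omega>) * exp (- of_bool (B ?t \<omega>)))"
      by (simp add: exp_add[symmetric])
    also have "\<dots> = expectation (\<lambda>\<omega>. exp (- ?N t \<omega>)) * expectation (\<lambda>\<omega>. exp (- of_bool (B ?t \<omega>)))"
    proof (rule expectation_mult_indep_set[OF space(1)[of ?t] space(2)[of ?t] indep _ int])
      show "integrable M (\<lambda>\<omega>. exp (- of_bool (B ?t \<omega>)) :: real)"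
        by (rule integrable_const_bound[where B = 1]) (use B_M[of ?t] in auto)
      show "(\<lambda>\<omega>. exp (- ?N t \<omega>)) \<in> borel_measurable (F ?t)"
        by measurable
      show "(\<lambda>\<omega>. exp (- of_bool (B ?t \<omega>)) :: real) \<in> borel_measurable (H ?t)"
        by measurable
    qed auto
    also have "\<dots> \<le> expectation (\<lambda>\<omega>. exp (- ?N t \<omega>)) * exp (- ?q * p ?t)"
      by (rule mult_left_mono[OF step]) simp
    also have "\<dots> \<le> exp (- ?q * (\<Sum>n=1..t. p n)) * exp (- ?q * p ?t)"
      using Suc by (intro mult_right_mono) auto
    also have "\<dots> = exp (- ?q * (\<Sum>n=1..?t. p n))"
      by (simp add: exp_add[symmetric] algebra_simps)
    finally show ?case .
  qed
  have "\<P>(\<omega> in M. ?N t \<omega> \<le> k) = \<P>(\<omega> in M. exp (- k) \<le> exp (- ?N t \<omega>))"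
    by simp
  also have "\<dots> \<le> expectation (\<lambda>\<omega>. exp (- ?N t \<omega>)) / exp (- k)"
    by (rule integral_Markov_inequality_measure[where A = "{}"]) (use int in auto)
  also have "\<dots> = exp k * expectation (\<lambda>\<omega>. exp (- ?N t \<omega>))"
    by (simp add: exp_minus field_simps)
  also have "\<dots> \<le> exp k * exp (- (1 - exp (- 1)) * (\<Sum>n=1..t. p n))"
    by (rule mult_left_mono[OF le]) simp
  finally show ?thesis .
qed

section \<open>Sigma-algebras of the strategy\<close>

context constrained_eps_greedy
begin

text \<open>Includes the arm and the randomization of time \<open>t\<close> itself, but samples only
  before \<open>t\<close>. Against \<open>future t\<close> it expresses that the choice of arm does
  not anticipate the samples.\<close>

definition past :: "nat \<Rightarrow> 'w measure" where
  "past t = vimage_algebra (space M)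
    (\<lambda>\<omega>. (\<lambda>s\<in>{1..t}. (I s \<omega>, randomization G U V s \<omega>),
          \<lambda>i\<in>sample_indices A {1..<t}. sample X Y i \<omega>))
    (PiM {1..t} (\<lambda>_. count_space UNIV) \<Otimes>\<^sub>M PiM (sample_indices A {1..<t}) (\<lambda>_. borel))"

definition future :: "nat \<Rightarrow> 'w measure" where
  "future t = vimage_algebra (space M)
    (\<lambda>\<omega>. \<lambda>i\<in>sample_indices A {t..}. sample X Y i \<omega>)
    (PiM (sample_indices A {t..}) (\<lambda>_. borel))"

text \<open>Decisions strictly before \<open>t\<close>, but samples of all times. Against
  \<open>draw t\<close> it expresses that the randomization at time \<open>t\<close> is
  fresh.\<close>

definition history :: "nat \<Rightarrow> 'w measure" where
  "history t = vimage_algebra (space M)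
    (\<lambda>\<omega>. (\<lambda>s\<in>{1..<t}. (I s \<omega>, randomization G U V s \<omega>),
          \<lambda>i\<in>sample_indices A {1..}. sample X Y i \<omega>))
    (PiM {1..<t} (\<lambda>_. count_space UNIV) \<Otimes>\<^sub>M PiM (sample_indices A {1..}) (\<lambda>_. borel))"

definition draw :: "nat \<Rightarrow> 'w measure" where
  "draw t = vimage_algebra (space M) (randomization G U V t) (count_space UNIV)"

lemma space_past: "space (past t) = space M"
  and space_future: "space (future t) = space M"
  and space_history: "space (history t) = space M"
  and space_draw: "space (draw t) = space M"
  by (simp_all add: past_def future_def history_def draw_def)

lemma indep_past_future: "t \<ge> 1 \<Longrightarrow> indep_set (sets (past t)) (sets (future t))"
  using nonanticipating[of t] by (simp add: generated_events_def past_def future_def)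

lemma indep_history_draw: "t \<ge> 1 \<Longrightarrow> indep_set (sets (history t)) (sets (draw t))"
  using fresh_randomization[of t]
  unfolding generated_events_def history_def[symmetric] draw_def[symmetric] indep_sets2_eq
  by (metis Int_commute mult.commute)

lemma measurable_past:
  "(\<lambda>\<omega>. (\<lambda>s\<in>{1..t}. (I s \<omega>, randomization G U V s \<omega>),
      \<lambda>i\<in>sample_indices A {1..<t}. sample X Y i \<omega>)) \<in> past t \<rightarrow>\<^sub>M
    PiM {1..t} (\<lambda>_. count_space UNIV) \<Otimes>\<^sub>M PiM (sample_indices A {1..<t}) (\<lambda>_. borel)"
  unfolding past_def by (rule measurable_vimage_algebra1) (auto simp: space_pair_measure space_PiM)

lemma sample_past:
  assumes "i \<in> sample_indices A {1..<t}"
  shows "sample X Y i \<in> borel_measurable (past t)"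
proof -
  let ?N = "PiM {1..t} (\<lambda>_. count_space UNIV :: ('a \<times> bool \<times> 'a \<times> 'a) measure) \<Otimes>\<^sub>M
    PiM (sample_indices A {1..<t}) (\<lambda>_. borel :: real measure)"
  have "(\<lambda>x. snd x i) \<in> ?N \<rightarrow>\<^sub>M borel"
    using assms by measurable
  from measurable_compose[OF measurable_past this] show ?thesis
    using assms by simp
qed

lemma arm_past:
  assumes "1 \<le> n" "n \<le> t"
  shows "Measurable.pred (past t) (\<lambda>\<omega>. I n \<omega> = a)"
proof -
  let ?N = "PiM {1..t} (\<lambda>_. count_space UNIV :: ('a \<times> bool \<times> 'a \<times> 'a) measure) \<Otimes>\<^sub>M
    PiM (sample_indices A {1..<t}) (\<lambda>_. borel :: real measure)"
  have [measurable]: "n \<in> {1..t}"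
    using assms by simp
  have "(\<lambda>x. fst x n) \<in> ?N \<rightarrow>\<^sub>M count_space UNIV"
    by measurable
  then have "(\<lambda>x. fst (fst x n) = a) \<in> ?N \<rightarrow>\<^sub>M count_space UNIV"
    by (rule measurable_compose) simp
  from measurable_compose[OF measurable_past this] show ?thesis
    using assms by simp
qed

lemma sample_future:
  assumes "i \<in> sample_indices A {t..}"
  shows "sample X Y i \<in> borel_measurable (future t)"
proof -
  have hist: "(\<lambda>\<omega>. \<lambda>i\<in>sample_indices A {t..}. sample X Y i \<omega>)
      \<in> future t \<rightarrow>\<^sub>M PiM (sample_indices A {t..}) (\<lambda>_. borel)"
    unfolding future_def by (rule measurable_vimage_algebra1) (auto simp: space_PiM)
  have "(\<lambda>x. x i) \<in> PiM (sample_indices A {t..}) (\<lambda>_. borel) \<rightarrow>\<^sub>M (borel :: real measure)"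
    using assms by measurable
  from measurable_compose[OF hist this] show ?thesis
    using assms by simp
qed

lemma randomization_draw: "randomization G U V t \<in> draw t \<rightarrow>\<^sub>M count_space UNIV"
  unfolding draw_def by (rule measurable_vimage_algebra1) auto

lemma randomization_measurable: "t \<ge> 1 \<Longrightarrow> randomization G U V t \<in> M \<rightarrow>\<^sub>M count_space UNIV"
  by (rule measurable_from_subalg[OF _ randomization_draw])
    (use indep_setD_ev2[OF indep_history_draw[of t]] in \<open>auto simp: subalgebra_def space_draw\<close>)

lemma randomization_history:
  assumes "1 \<le> n" "n < t"
  shows "randomization G U V n \<in> history t \<rightarrow>\<^sub>M count_space UNIV"
proof -
  let ?N = "PiM {1..<t} (\<lambda>_. count_space UNIV :: ('a \<times> bool \<times> 'a \<times> 'a) measure) \<Otimes>\<^sub>M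
    PiM (sample_indices A {1..}) (\<lambda>_. borel :: real measure)"
  have hist: "(\<lambda>\<omega>. (\<lambda>s\<in>{1..<t}. (I s \<omega>, randomization G U V s \<omega>),
      \<lambda>i\<in>sample_indices A {1..}. sample X Y i \<omega>)) \<in> history t \<rightarrow>\<^sub>M ?N"
    unfolding history_def by (rule measurable_vimage_algebra1) (auto simp: space_pair_measure space_PiM)
  have [measurable]: "n \<in> {1..<t}"
    using assms by simp
  have "(\<lambda>x. fst x n) \<in> ?N \<rightarrow>\<^sub>M count_space UNIV"
    by measurable
  then have "(\<lambda>x. snd (fst x n)) \<in> ?N \<rightarrow>\<^sub>M count_space UNIV"
    by (rule measurable_compose) simp
  from measurable_compose[OF hist this] show ?thesis
    using assms by simp
qed

lemma sample_measurable:
  "i \<in> sample_indices A {1..} \<Longrightarrow> sample X Y i \<in> borel_measurable M"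
  using indep_samples by (auto simp: indep_vars_def)

section \<open>Rewards and costs of one arm as selected samples\<close>

lemma selected_rewards:
  assumes a: "a \<in> A"
  shows "selected_samples M past future (X a) (\<lambda>n \<omega>. I n \<omega> = a) (\<mu> a)"
proof (unfold_locales, goal_cases)
  \<comment> \<open>The numbered goals are \<open>Z_past\<close> (4), \<open>Z_future\<close> (6)
    and \<open>Z_mean\<close> (8).\<close>
  case (4 n t)
  then show ?case
    using sample_past[of "Inl (a, n)" t] a by (simp add: sample_indices_def sample_def Plus_def image_iff)
next
  case (6 t)
  then show ?case
    using sample_future[of "Inl (a, t)" t] a by (simp add: sample_indices_def sample_def Plus_def image_iff)
next
  case (8 t)
  have [measurable]: "X a n \<in> borel_measurable M" if "n \<ge> 1" for n
    using sample_measurable[of "Inl (a, n)"] a that by (simp add: sample_indices_def sample_def Plus_def image_iff)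
  \<comment> \<open>The mean depends only on the distribution, so the mean at time 1 carries over to
    all times.\<close>
  have "expectation (X a n) = integral\<^sup>L (distr M borel (X a n)) (\<lambda>x. x)" if "n \<ge> 1" for n
    using that by (subst integral_distr) auto
  then show ?case
    using 8 reward_distr[of a t] reward_mean[of a] a by simp
qed (use a reward_range in \<open>auto simp: space_past space_future indep_past_future arm_past\<close>)

lemma selected_costs:
  assumes a: "a \<in> A"
  shows "selected_samples M past future (Y a) (\<lambda>n \<omega>. I n \<omega> = a) (c a)"
proof (unfold_locales, goal_cases)
  case (4 n t)
  then show ?case
    using sample_past[of "Inr (a, n)" t] a by (simp add: sample_indices_def sample_def Plus_def image_iff)
next
  case (6 t)
  then show ?case
    using sample_future[of "Inr (a, t)" t] a by (simp add: sample_indices_def sample_def Plus_def image_iff)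
next
  case (8 t)
  have [measurable]: "Y a n \<in> borel_measurable M" if "n \<ge> 1" for n
    using sample_measurable[of "Inr (a, n)"] a that by (simp add: sample_indices_def sample_def Plus_def image_iff)
  have "expectation (Y a n) = integral\<^sup>L (distr M borel (Y a n)) (\<lambda>x. x)" if "n \<ge> 1" for n
    using that by (subst integral_distr) auto
  then show ?case
    using 8 cost_distr[of a t] cost_mean[of a] a by simp
qed (use a cost_range in \<open>auto simp: space_past space_future indep_past_future arm_past\<close>)

section \<open>Random selections and the growth of the number of plays\<close>

lemma arms_nonempty: "A \<noteq> {}"
  using two_arms by auto

lemma prob_randomization:
  assumes "t \<ge> 1"
  shows "\<P>(\<omega> in M. randomization G U V t \<omega> \<in> S) =
    measure_pmf.prob
      (pair_pmf (bernoulli_pmf (1 - \<epsilon> t)) (pair_pmf (pmf_of_set A) (pmf_of_set A))) S"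
proof -
  have "measure (distr M (count_space UNIV) (randomization G U V t)) S =
      prob (randomization G U V t -` S \<inter> space M)"
    using randomization_measurable[OF assms] by (intro measure_distr) auto
  then show ?thesis
    using randomization_distr[OF assms] by (simp add: vimage_def Int_def conj_commute)
qed

lemma prob_random_selection:
  assumes "t \<ge> 1" "\<epsilon> t \<in> {0<..1}"
  shows "\<P>(\<omega> in M. \<not> G t \<omega>) = \<epsilon> t"
proof -
  \<comment> \<open>Both draws always lie in \<open>A\<close>, so the event is that of a finite
    product set, and the product distribution factorizes on it.\<close>
  have "\<P>(\<omega> in M. \<not> G t \<omega>) = \<P>(\<omega> in M. randomization G U V t \<omega> \<in> {False} \<times> (A \<times> A))"
    using draw_measurable[OF assms(1)]
    by (intro arg_cong[where f = prob]) (auto simp: randomization_def dest: measurable_space)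
  also have "\<dots> = \<epsilon> t"
    unfolding prob_randomization[OF assms(1)] using assms finite_arms arms_nonempty
    by (simp add: measure_pmf_prob_product countable_finite measure_pmf_single
        measure_pmf_of_set)
  finally show ?thesis .
qed

lemma prob_random_selection_arm:
  assumes "t \<ge> 1" "\<epsilon> t \<in> {0<..1}" "a \<in> A"
  shows "\<P>(\<omega> in M. \<not> G t \<omega> \<and> U t \<omega> = a) = \<epsilon> t / card A"
proof -
  have "\<P>(\<omega> in M. \<not> G t \<omega> \<and> U t \<omega> = a) =
      \<P>(\<omega> in M. randomization G U V t \<omega> \<in> {False} \<times> ({a} \<times> A))"
    using draw_measurable[OF assms(1)]
    by (intro arg_cong[where f = prob]) (auto simp: randomization_def dest: measurable_space)
  also have "\<dots> = \<epsilon> t / card A"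
    unfolding prob_randomization[OF assms(1)] using assms finite_arms arms_nonempty
    by (simp add: measure_pmf_prob_product countable_finite measure_pmf_single
        measure_pmf_of_set)
  finally show ?thesis .
qed

lemma plays_eq_sum: "real (plays I a t \<omega>) = (\<Sum>n=1..t. of_bool (I n \<omega> = a))"
  by (simp add: plays_def Int_def)

lemma arm_event [measurable]:
  assumes "n \<ge> 1"
  shows "Measurable.pred M (\<lambda>\<omega>. I n \<omega> = a)"
  by (rule measurable_from_subalg[OF _ arm_past[of n n]])
    (use assms indep_setD_ev1[OF indep_past_future[of n]] in \<open>auto simp: subalgebra_def space_past\<close>)

lemma tendsto_prob_plays_le:
  assumes eps: "\<And>t. t \<ge> 1 \<Longrightarrow> \<epsilon> t \<in> {0<..1}"
    and diverges: "filterlim (\<lambda>n. \<Sum>t=1..n. \<epsilon> t) at_top sequentially"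
    and a: "a \<in> A"
  shows "(\<lambda>t. \<P>(\<omega> in M. real (plays I a t \<omega>) \<le> k)) \<longlonglongrightarrow> 0"
proof (rule tendsto_sandwich[OF _ _ tendsto_const])
  \<comment> \<open>Success at time \<open>t\<close>: a random selection that draws
    \<open>a\<close>. It depends only on the randomization of time \<open>t\<close>, hence is
    measurable in \<open>draw t\<close> and in each later \<open>history\<close>.\<close>
  define B where "B t \<omega> \<longleftrightarrow> \<not> G t \<omega> \<and> U t \<omega> = a" for t \<omega>
  let ?q = "(1 - exp (- 1)) / card A :: real"
  let ?u = "\<lambda>t. exp k * exp (- (1 - exp (- 1)) * (\<Sum>n=1..t. \<epsilon> n / card A))"
  have B_draw: "Measurable.pred N (B n)"
    if "randomization G U V n \<in> N \<rightarrow>\<^sub>M count_space UNIV" for n N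
    using measurable_compose[OF that, of "\<lambda>(g, u, v). \<not> g \<and> u = a" "count_space UNIV"]
    by (simp add: randomization_def B_def[abs_def])
  have prob_B: "\<P>(\<omega> in M. B n \<omega>) = \<epsilon> n / card A" if "n \<ge> 1" for n
    using prob_random_selection_arm[OF that eps[OF that] a] by (simp add: B_def)
  have B_le: "\<P>(\<omega> in M. (\<Sum>n=1..t. of_bool (B n \<omega>)) \<le> k) \<le> ?u t" for t
    by (rule prob_few_successes_le[where F = history and H = draw])
      (auto simp: space_history space_draw indep_history_draw B_draw randomization_history
        randomization_draw prob_B)
  have B_M: "Measurable.pred M (B n)" if "n \<ge> 1" for n
    using B_draw randomization_measurable that by blast
  have plays_le: "\<P>(\<omega> in M. real (plays I a t \<omega>) \<le> k) \<le> ?u t" for t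
  proof -
    have [measurable]: "Measurable.pred M (B n)" if "n \<in> {1..t}" for n
      using that B_M by simp
    \<comment> \<open>Each success is a play of \<open>a\<close>, because a random selection plays
      its draw. Greedy plays of \<open>a\<close> can only increase the count.\<close>
    have "(\<Sum>n=1..t. of_bool (B n \<omega>)) \<le> real (plays I a t \<omega>)" if "\<omega> \<in> space M" for \<omega>
      unfolding plays_eq_sum using that random_selection by (intro sum_mono) (auto simp: B_def)
    then have "\<P>(\<omega> in M. real (plays I a t \<omega>) \<le> k) \<le>
        \<P>(\<omega> in M. (\<Sum>n=1..t. of_bool (B n \<omega>)) \<le> k)"
      by (intro finite_measure_mono) (force, measurable)
    with B_le show ?thesis by (rule order_trans[rotated])
  qed
  show "\<forall>\<^sub>F t in sequentially. \<P>(\<omega> in M. real (plays I a t \<omega>) \<le> k) \<le> ?u t"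
    using plays_le by simp
  have "?q > 0"
    using finite_arms arms_nonempty by (simp add: card_gt_0_iff)
  have "filterlim (\<lambda>t. ?q * (\<Sum>n=1..t. \<epsilon> n)) at_top sequentially"
    by (rule filterlim_tendsto_pos_mult_at_top[OF tendsto_const \<open>?q > 0\<close> diverges])
  then have "filterlim (\<lambda>t. - (?q * (\<Sum>n=1..t. \<epsilon> n))) at_bot sequentially"
    by (simp add: filterlim_uminus_at_bot)
  then have "(\<lambda>t. exp k * exp (- (?q * (\<Sum>n=1..t. \<epsilon> n)))) \<longlonglongrightarrow> exp k * 0"
    by (intro tendsto_mult_left filterlim_compose[OF exp_at_bot])
  moreover have "?u t = exp k * exp (- (?q * (\<Sum>n=1..t. \<epsilon> n)))" for t
    by (simp add: sum_divide_distrib[symmetric] diff_divide_distrib algebra_simps)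
  ultimately show "?u \<longlonglongrightarrow> 0"
    by simp
qed simp

section \<open>Consistency of the sample averages\<close>

text \<open>An arm without plays counts as inaccurate: its average is the default 0, and membership
  in \<open>empirically_feasible\<close> requires a play.\<close>

definition inaccurate :: "('a \<Rightarrow> nat \<Rightarrow> 'w \<Rightarrow> real) \<Rightarrow> real \<Rightarrow> real \<Rightarrow> 'a \<Rightarrow> nat \<Rightarrow> 'w set" where
  "inaccurate Z m d a t =
    {\<omega> \<in> space M. plays I a t \<omega> = 0 \<or> d \<le> \<bar>sample_avg I Z a t \<omega> - m\<bar>}"

lemma inaccurate_event:
  assumes "\<And>n. 1 \<le> n \<Longrightarrow> Z a n \<in> borel_measurable M"
  shows "inaccurate Z m d a t \<in> events"
proof -
  have [measurable]: "Z a n \<in> borel_measurable M" if "n \<in> {1..t}" for n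
    using that assms by auto
  have [measurable]: "(\<lambda>\<omega>. real (plays I a t \<omega>)) \<in> borel_measurable M"
    unfolding plays_eq_sum by measurable
  have "inaccurate Z m d a t = {\<omega> \<in> space M. real (plays I a t \<omega>) = 0 \<or>
      d \<le> \<bar>(if real (plays I a t \<omega>) \<ge> 1
        then (\<Sum>n=1..t. Z a n \<omega> * of_bool (I n \<omega> = a)) / real (plays I a t \<omega>) else 0) - m\<bar>}"
    unfolding inaccurate_def sample_avg_def by (intro Collect_cong) auto
  also have "\<dots> \<in> events" by measurable
  finally show ?thesis .
qed

lemma tendsto_prob_inaccurate:
  assumes sel: "selected_samples M past future (Z a) (\<lambda>n \<omega>. I n \<omega> = a) m"
    and plays: "\<And>k. (\<lambda>t. \<P>(\<omega> in M. real (plays I a t \<omega>) \<le> k)) \<longlonglongrightarrow> 0"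
    and d: "0 < d"
  shows "(\<lambda>t. prob (inaccurate Z m d a t)) \<longlonglongrightarrow> 0"
proof (rule LIMSEQ_I)
  fix e :: real assume e: "e > 0"
  interpret selected_samples M past future "Z a" "\<lambda>n \<omega>. I n \<omega> = a" m
    by (rule sel)
  let ?S = "\<lambda>t \<omega>. \<Sum>n=1..t. (Z a n \<omega> - m) * of_bool (I n \<omega> = a)"
  have "filterlim (\<lambda>k. - (2 * d\<^sup>2 * real k)) at_bot sequentially"
    unfolding filterlim_uminus_at_bot minus_minus
    by (rule filterlim_tendsto_pos_mult_at_top[OF tendsto_const _ filterlim_real_sequentially])
      (use d in simp)
  then have "(\<lambda>k. 2 * exp (- 2 * d\<^sup>2 * real k)) \<longlonglongrightarrow> 2 * 0"
    by (intro tendsto_mult_left filterlim_compose[OF exp_at_bot]) simp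
  then have "\<forall>\<^sub>F k in sequentially. 2 * exp (- 2 * d\<^sup>2 * real k) < e / 2"
    by (rule order_tendstoD(2)) (use e in simp)
  \<comment> \<open>The deviation bound is uniform in time, so \<open>k\<close> depends on
    \<open>d\<close> and \<open>e\<close> only. Afterwards \<open>t0\<close> makes at most
    \<open>k\<close> plays unlikely.\<close>
  then obtain k :: nat where k: "2 * exp (- 2 * d\<^sup>2 * real k) < e / 2"
    by (auto simp: eventually_sequentially)
  obtain t0 where t0: "\<P>(\<omega> in M. real (plays I a t \<omega>) \<le> real k) < e / 2" if "t \<ge> t0" for t
    using order_tendstoD(2)[OF plays[of k], of "e / 2"] e by (auto simp: eventually_sequentially)
  have "prob (inaccurate Z m d a t) < e" if t: "t \<ge> t0" for t
  proof -
    let ?P = "{\<omega> \<in> space M. real (plays I a t \<omega>) \<le> real k}"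
    let ?D = "{\<omega> \<in> space M. real k \<le> (\<Sum>n=1..t. of_bool (I n \<omega> = a)) \<and>
        d * (\<Sum>n=1..t. of_bool (I n \<omega> = a)) \<le> \<bar>?S t \<omega>\<bar>}"
    have [measurable]: "Z a n \<in> borel_measurable M" if "n \<in> {1..t}" for n
      using that by (auto intro: Z_measurable)
    have P: "?P \<in> events"
      unfolding plays_eq_sum by measurable
    have D: "?D \<in> events"
      by measurable
    have "inaccurate Z m d a t \<subseteq> ?P \<union> ?D"
    proof
      fix \<omega> assume \<omega>: "\<omega> \<in> inaccurate Z m d a t"
      show "\<omega> \<in> ?P \<union> ?D"
      proof (cases "plays I a t \<omega> \<le> k")
        case False
        then have pos: "real (plays I a t \<omega>) > 0" by simp
        have S: "?S t \<omega> = (\<Sum>n=1..t. Z a n \<omega> * of_bool (I n \<omega> = a)) - m * real (plays I a t \<omega>)"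
          unfolding plays_eq_sum by (simp add: left_diff_distrib sum_subtractf sum_distrib_left)
        have "d \<le> \<bar>sample_avg I Z a t \<omega> - m\<bar>"
          using \<omega> pos by (auto simp: inaccurate_def)
        also have "sample_avg I Z a t \<omega> - m = ?S t \<omega> / real (plays I a t \<omega>)"
          using pos unfolding S sample_avg_def by (simp add: field_simps)
        finally have "d * real (plays I a t \<omega>) \<le> \<bar>?S t \<omega>\<bar>"
          using pos by (simp add: field_simps)
        with False \<omega> show ?thesis
          unfolding plays_eq_sum[symmetric] by (auto simp: inaccurate_def)
      qed (use \<omega> in \<open>auto simp: inaccurate_def\<close>)
    qed
    then have "prob (inaccurate Z m d a t) \<le> prob (?P \<union> ?D)"
      using P D by (intro finite_measure_mono) auto
    also have "\<dots> \<le> prob ?P + prob ?D"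
      using P D by (rule measure_Un_le)
    also have "\<dots> < e / 2 + e / 2"
      using t0[OF t] prob_deviation_le[OF d, of "real k" t] k by (intro add_strict_mono) linarith+
    finally show ?thesis by simp
  qed
  then show "\<exists>t0. \<forall>t\<ge>t0. norm (prob (inaccurate Z m d a t) - 0) < e"
    by auto
qed

section \<open>Optimality of greedy selections\<close>

text \<open>A cost average closer to \<open>c a\<close> than \<open>h\<close> lies on the same side
  of \<open>C\<close> as \<open>c a\<close>, so the empirically feasible arms are exactly the
  feasible ones. Reward averages with errors below \<open>r / 2\<close> cannot reverse the order of
  two means at least \<open>r\<close> apart.\<close>

lemma greedy_optimal:
  assumes \<omega>: "\<omega> \<in> space M" and t: "t \<ge> 1" and greedy: "G t \<omega>"
    and cost_gap: "\<And>a. a \<in> A \<Longrightarrow> h \<le> \<bar>c a - C\<bar>"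
    and reward_gap: "\<And>a b. a \<in> A \<Longrightarrow> b \<in> A \<Longrightarrow> a \<noteq> b \<Longrightarrow> r \<le> \<bar>\<mu> a - \<mu> b\<bar>"
    and rewards: "\<And>a. a \<in> A \<Longrightarrow> \<omega> \<notin> inaccurate X (\<mu> a) (r / 2) a (t - 1)"
    and costs: "\<And>a. a \<in> A \<Longrightarrow> \<omega> \<notin> inaccurate Y (c a) h a (t - 1)"
  shows "is_arg_max \<mu> (\<lambda>a. a \<in> feasible_arms A c C) (I t \<omega>)"
proof -
  have "sample_avg I Y a (t - 1) \<omega> \<le> C \<longleftrightarrow> c a \<le> C" if "a \<in> A" for a
    using costs[OF that] cost_gap[OF that] \<omega> by (auto simp: inaccurate_def)
  then have feasible: "empirically_feasible A I Y C t \<omega> = feasible_arms A c C"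
    using costs \<omega> by (auto simp: empirically_feasible_def feasible_arms_def inaccurate_def)
  have max: "is_arg_max (\<lambda>a. sample_avg I X a (t - 1) \<omega>) (\<lambda>a. a \<in> feasible_arms A c C) (I t \<omega>)"
    using greedy_selection[OF t \<omega> greedy] feasible feasible_nonempty by simp
  have "\<not> \<mu> b > \<mu> a" if "a \<in> A" "b \<in> A"
    "\<not> sample_avg I X b (t - 1) \<omega> > sample_avg I X a (t - 1) \<omega>" for a b
  proof (cases "a = b")
    case False
    have "\<bar>sample_avg I X a' (t - 1) \<omega> - \<mu> a'\<bar> < r / 2" if "a' \<in> A" for a'
      using rewards[OF that] \<omega> by (simp add: inaccurate_def)
    from this[OF that(1)] this[OF that(2)] reward_gap[OF that(1,2) False] that(3)
    show ?thesis by linarith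
  qed simp
  with max show ?thesis
    unfolding is_arg_max_def feasible_arms_def by blast
qed

end

section \<open>Positive gaps and the limit\<close>

lemma cost_gap_le: "finite A \<Longrightarrow> a \<in> A \<Longrightarrow> cost_gap A c C \<le> \<bar>c a - C\<bar>"
  unfolding cost_gap_def by (intro Min_le) auto

lemma cost_gap_pos:
  assumes "finite A" "A \<noteq> {}" "cost_gap A c C \<noteq> 0"
  shows "cost_gap A c C > 0"
proof -
  have "cost_gap A c C \<in> {\<bar>c a - C\<bar> | a. a \<in> A}"
    unfolding cost_gap_def using assms by (intro Min_in) auto
  then show ?thesis using assms(3) by force
qed

lemma finite_reward_gaps:
  "finite A \<Longrightarrow> finite {\<bar>\<mu> a - \<mu> b\<bar> | a b. a \<in> A \<and> b \<in> A \<and> a \<noteq> b}"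
  by (rule finite_subset[of _ "(\<lambda>(a, b). \<bar>\<mu> a - \<mu> b\<bar>) ` (A \<times> A)"]) auto

lemma reward_gap_le:
  "finite A \<Longrightarrow> a \<in> A \<Longrightarrow> b \<in> A \<Longrightarrow> a \<noteq> b \<Longrightarrow> reward_gap A \<mu> \<le> \<bar>\<mu> a - \<mu> b\<bar>"
  unfolding reward_gap_def by (intro Min_le finite_reward_gaps) auto

lemma reward_gap_pos:
  assumes "card A \<ge> 2" "reward_gap A \<mu> \<noteq> 0"
  shows "reward_gap A \<mu> > 0"
proof -
  \<comment> \<open>An infinite set has \<open>card\<close> 0.\<close>
  have fin: "finite A" using assms(1) card.infinite by fastforce
  obtain a b where "a \<in> A" "b \<in> A" "a \<noteq> b"
    using assms(1) card_le_Suc0_iff_eq[OF fin] by auto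
  then have "{\<bar>\<mu> a - \<mu> b\<bar> | a b. a \<in> A \<and> b \<in> A \<and> a \<noteq> b} \<noteq> {}" by blast
  then have "reward_gap A \<mu> \<in> {\<bar>\<mu> a - \<mu> b\<bar> | a b. a \<in> A \<and> b \<in> A \<and> a \<noteq> b}"
    unfolding reward_gap_def by (intro Min_in finite_reward_gaps fin)
  then show ?thesis using assms(2) by force
qed

theorem mainTheorem2:
  fixes M :: "'w measure" and A :: "'a set"
    and X Y :: "'a \<Rightarrow> nat \<Rightarrow> 'w \<Rightarrow> real"
    and \<mu> c :: "'a \<Rightarrow> real" and C :: real
    and \<epsilon> :: "nat \<Rightarrow> real"
    and I :: "nat \<Rightarrow> 'w \<Rightarrow> 'a" and G :: "nat \<Rightarrow> 'w \<Rightarrow> bool" and U V :: "nat \<Rightarrow> 'w \<Rightarrow> 'a"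
  assumes "\<And>t. t \<ge> 1 \<Longrightarrow> \<epsilon> t \<in> {0<..1}"
    and "constrained_eps_greedy M A X Y \<mu> c C \<epsilon> I G U V"
    and "filterlim (\<lambda>n. \<Sum>t=1..n. \<epsilon> t) at_top sequentially"
    and "\<epsilon> \<longlonglongrightarrow> 0"
    and "cost_gap A c C \<noteq> 0"
    and "reward_gap A \<mu> \<noteq> 0"
  shows "(\<lambda>t. \<P>(\<omega> in M. is_arg_max \<mu> (\<lambda>a. a \<in> feasible_arms A c C) (I t \<omega>))) \<longlonglongrightarrow> 1"
proof -
  interpret constrained_eps_greedy M A X Y \<mu> c C \<epsilon> I G U V
    by (rule assms(2))
  let ?h = "cost_gap A c C" and ?r = "reward_gap A \<mu>"
  let ?opt = "\<lambda>t \<omega>. is_arg_max \<mu> (\<lambda>a. a \<in> feasible_arms A c C) (I t \<omega>)"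
  let ?RX = "\<lambda>a t. inaccurate X (\<mu> a) (?r / 2) a t"
  let ?RY = "\<lambda>a t. inaccurate Y (c a) ?h a t"
  \<comment> \<open>Union bound for the failure at time \<open>Suc t\<close>: a random selection, or
    an inaccurate average. The averages are taken after \<open>t\<close> plays, since the selection
    at \<open>Suc t\<close> uses just those.\<close>
  let ?b = "\<lambda>t. \<epsilon> (Suc t) + (\<Sum>a\<in>A. prob (?RX a t)) + (\<Sum>a\<in>A. prob (?RY a t))"
  have pos: "?h > 0" "?r / 2 > 0"
    using cost_gap_pos[OF finite_arms arms_nonempty assms(5)] reward_gap_pos[OF two_arms assms(6)]
    by simp_all
  have plays: "(\<lambda>t. \<P>(\<omega> in M. real (plays I a t \<omega>) \<le> k)) \<longlonglongrightarrow> 0" if "a \<in> A" for a k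
    using tendsto_prob_plays_le[OF assms(1) assms(3) that] .
  have "(\<lambda>t. prob (?RX a t)) \<longlonglongrightarrow> 0" "(\<lambda>t. prob (?RY a t)) \<longlonglongrightarrow> 0" if "a \<in> A" for a
    using that pos by (auto intro!: tendsto_prob_inaccurate selected_rewards selected_costs plays)
  then have "?b \<longlonglongrightarrow> 0 + (\<Sum>a\<in>A. 0) + (\<Sum>a\<in>A. 0)"
    by (intro tendsto_add tendsto_sum LIMSEQ_Suc assms(4))
  then have b: "?b \<longlonglongrightarrow> 0" by simp
  have bound: "1 - ?b t \<le> \<P>(\<omega> in M. ?opt (Suc t) \<omega>)" for t
  proof -
    let ?Q = "{\<omega> \<in> space M. \<not> G (Suc t) \<omega>}"
    have "Measurable.pred M (?opt (Suc t))"
      by (rule measurable_compose[OF arm_measurable]) simp_all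
    then have opt: "{\<omega> \<in> space M. ?opt (Suc t) \<omega>} \<in> events"
      by simp
    have Q: "?Q \<in> events"
      using mode_measurable[of "Suc t"] by measurable
    have R: "?RX a t \<in> events" "?RY a t \<in> events" if "a \<in> A" for a
      using selected_samples.Z_measurable[OF selected_rewards[OF that]]
        selected_samples.Z_measurable[OF selected_costs[OF that]]
      by (auto intro!: inaccurate_event)
    have U: "(\<Union>a\<in>A. ?RX a t) \<in> events" "(\<Union>a\<in>A. ?RY a t) \<in> events"
      using R finite_arms by auto
    have "space M - {\<omega> \<in> space M. ?opt (Suc t) \<omega>} \<subseteq>
        ?Q \<union> (\<Union>a\<in>A. ?RX a t) \<union> (\<Union>a\<in>A. ?RY a t)"
    proof
      fix \<omega> assume \<omega>: "\<omega> \<in> space M - {\<omega> \<in> space M. ?opt (Suc t) \<omega>}"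
      show "\<omega> \<in> ?Q \<union> (\<Union>a\<in>A. ?RX a t) \<union> (\<Union>a\<in>A. ?RY a t)"
      proof (rule ccontr)
        assume "\<omega> \<notin> ?Q \<union> (\<Union>a\<in>A. ?RX a t) \<union> (\<Union>a\<in>A. ?RY a t)"
        with \<omega> have "?opt (Suc t) \<omega>"
          by (intro greedy_optimal[of \<omega> "Suc t" ?h ?r] cost_gap_le reward_gap_le finite_arms) auto
        with \<omega> show False by simp
      qed
    qed
    then have "prob (space M - {\<omega> \<in> space M. ?opt (Suc t) \<omega>}) \<le>
        prob (?Q \<union> (\<Union>a\<in>A. ?RX a t) \<union> (\<Union>a\<in>A. ?RY a t))"
      using Q U by (intro finite_measure_mono sets.Un) auto
    also have "\<dots> \<le> prob (?Q \<union> (\<Union>a\<in>A. ?RX a t)) + prob (\<Union>a\<in>A. ?RY a t)"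
      using Q U by (intro measure_Un_le) auto
    also have "\<dots> \<le> prob ?Q + prob (\<Union>a\<in>A. ?RX a t) + prob (\<Union>a\<in>A. ?RY a t)"
      using Q U by (intro add_right_mono measure_Un_le) auto
    also have "\<dots> \<le> ?b t"
      using R finite_arms prob_random_selection[of "Suc t"] assms(1)[of "Suc t"]
      by (intro add_mono finite_measure_subadditive_finite) auto
    finally show ?thesis
      using prob_compl[OF opt] by simp
  qed
  have "(\<lambda>t. \<P>(\<omega> in M. ?opt (Suc t) \<omega>)) \<longlonglongrightarrow> 1"
  proof (rule tendsto_sandwich[OF _ _ _ tendsto_const])
    show "(\<lambda>t. 1 - ?b t) \<longlonglongrightarrow> 1"
      using tendsto_diff[OF tendsto_const b, of 1] by simp
  qed (use bound in auto)
  then show ?thesis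
    \<comment> \<open>Undoes the shift, which kept time 0, where no play takes place, out of the
      estimate.\<close>
    by (rule LIMSEQ_imp_Suc)
qed

end
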